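(* For the infinite hexagonal grid $\mathrm{HEX}$, $\tfrac{4}{7} \le \mathrm{RED{:}IC}\%(\mathrm{HEX}) \le \tfrac{2}{3}$.
   Context: $\mathrm{HEX}$ is the infinite hexagonal (honeycomb) lattice, a 3-regular planar graph. $N[v]$ denotes the closed neighborhood of $v$ and $\Delta$ symmetric difference. A set $S \subseteq V(G)$ is a redundant identifying code (RED:IC) if every vertex $v$ satisfies $|N[v] \cap S| \ge 2$ and every pair of distinct vertices $u,v$ satisfies $|(N[u]\cap S)\,\Delta\,(N[v]\cap S)| \ge 2$. For an infinite graph the density of $S$ is $\limsup_{r\to\infty} |S \cap B_r(v_0)|/|B_r(v_0)|$ for a fixed vertex $v_0$, where $B_r(v_0)$ is the set of vertices within distance $r$ of $v_0$; $\mathrm{RED{:}IC}\%(G)$ is the minimum (infimum) density of a RED:IC of $G$. *)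

theory Defs
  imports Complex_Main "HOL-Library.Extended_Nat" "HOL-Library.Extended_Real"
    "HOL-Library.Liminf_Limsup"
begin

(* A graph is a symmetric irreflexive adjacency relation E whose vertex set is the
   whole type 'a.  Cardinalities below are natural numbers, so these notions are meant
   for locally finite graphs (card of an infinite set is 0); balls and closed
   neighbourhoods of the honeycomb lattice are finite, see finite_hex_ball. *)

definition closed_nbhd :: "('a \<Rightarrow> 'a \<Rightarrow> bool) \<Rightarrow> 'a \<Rightarrow> 'a set" where
  "closed_nbhd E v = insert v {u. E v u}"

definition red_ic :: "('a \<Rightarrow> 'a \<Rightarrow> bool) \<Rightarrow> 'a set \<Rightarrow> bool" where
  "red_ic E S \<longleftrightarrow>
     (\<forall>v. card (closed_nbhd E v \<inter> S) \<ge> 2) \<and>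
     (\<forall>u v. u \<noteq> v \<longrightarrow> card (sym_diff (closed_nbhd E u \<inter> S) (closed_nbhd E v \<inter> S)) \<ge> 2)"

(* Length of a shortest walk; the infimum of the empty set is \<infinity>. *)
definition graph_dist :: "('a \<Rightarrow> 'a \<Rightarrow> bool) \<Rightarrow> 'a \<Rightarrow> 'a \<Rightarrow> enat" where
  "graph_dist E u v = Inf (enat ` {n. (E ^^ n) u v})"

definition graph_ball :: "('a \<Rightarrow> 'a \<Rightarrow> bool) \<Rightarrow> 'a \<Rightarrow> nat \<Rightarrow> 'a set" where
  "graph_ball E v r = {u. graph_dist E v u \<le> enat r}"

definition code_density :: "('a \<Rightarrow> 'a \<Rightarrow> bool) \<Rightarrow> 'a \<Rightarrow> 'a set \<Rightarrow> ereal" where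
  "code_density E v0 S =
     limsup (\<lambda>r. ereal (real (card (S \<inter> graph_ball E v0 r)) / real (card (graph_ball E v0 r))))"

definition red_ic_percent :: "('a \<Rightarrow> 'a \<Rightarrow> bool) \<Rightarrow> 'a \<Rightarrow> ereal" where
  "red_ic_percent E v0 = (INF S\<in>{S. red_ic E S}. code_density E v0 S)"

(* The honeycomb lattice as two interleaved triangular lattices: (i, j, c) is the vertex of
   the unit cell (i, j) in the sublattice selected by c.  Edges join the two sublattices. *)

type_synonym hex_vertex = "int \<times> int \<times> bool"

definition hex_edge :: "hex_vertex \<Rightarrow> hex_vertex \<Rightarrow> bool" where
  "hex_edge u v \<longleftrightarrow>
     (\<exists>i j. u = (i, j, False) \<and> v \<in> {(i, j, True), (i - 1, j, True), (i, j - 1, True)})"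

definition hex :: "hex_vertex \<Rightarrow> hex_vertex \<Rightarrow> bool" where
  "hex = symclp hex_edge"

(* The standard drawing of the honeycomb by regular hexagons of side 1: adjacency is
   exactly being at Euclidean distance 1. *)
definition hex_point :: "hex_vertex \<Rightarrow> complex" where
  "hex_point = (\<lambda>(i, j, c).
     Complex (3 / 2 * of_int (i + j) + (if c then 1 else 0)) (sqrt 3 / 2 * of_int (i - j)))"

lemma hex_point_dist_sq:
  "(dist (hex_point (i, j, c)) (hex_point (k, l, d)))\<^sup>2 =
     of_int (3 * ((i-k)^2 + (i-k)*(j-l) + (j-l)^2) +
       3 * (i-k + (j-l)) * (of_bool c - of_bool d) + (of_bool c - of_bool d)^2)"
proof -
  define x y t :: real where "x = of_int (i - k)" and "y = of_int (j - l)"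
    and "t = of_bool c - of_bool d"
  have "hex_point (i, j, c) - hex_point (k, l, d) = Complex (3 / 2 * (x + y) + t) (sqrt 3 / 2 * (x - y))"
    by (simp add: hex_point_def x_def y_def t_def complex_eq_iff field_simps)
  then have "(dist (hex_point (i, j, c)) (hex_point (k, l, d)))\<^sup>2 =
      (3 / 2 * (x + y) + t)^2 + (sqrt 3)^2 / 4 * (x - y)^2"
    by (simp add: dist_norm cmod_power2 power_mult_distrib power_divide)
  also have "\<dots> = 3 * (x^2 + x * y + y^2) + 3 * (x + y) * t + t^2"
    by (simp add: power2_eq_square field_simps)
  finally show ?thesis by (simp add: x_def y_def t_def)
qed

lemma dist_1_iff: "dist (x::complex) y = 1 \<longleftrightarrow> (dist x y)\<^sup>2 = of_int 1"
  by (simp add: power2_eq_1_iff) (smt (verit) zero_le_dist)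

lemma quadratic_form_nonneg: "a^2 + a*b + b^2 \<ge> (0::int)"
proof -
  have "2 * (a^2 + a*b + b^2) = a^2 + b^2 + (a+b)^2" by (simp add: power2_eq_square algebra_simps)
  then show ?thesis by (smt (verit) zero_le_power2)
qed

lemma quadratic_form_0_iff: "a^2 + a*b + b^2 = (0::int) \<longleftrightarrow> a = 0 \<and> b = 0"
proof
  assume *: "a^2 + a*b + b^2 = 0"
  have "2 * (a^2 + a*b + b^2) = a^2 + b^2 + (a+b)^2" by (simp add: power2_eq_square algebra_simps)
  with * have "a^2 + b^2 + (a+b)^2 = 0" by simp
  then have "a^2 = 0" "b^2 = 0" by (smt (verit) zero_le_power2)+
  then show "a = 0 \<and> b = 0" by simp
qed simp

lemma quadratic_1_iff:
  "a^2 + a*b + b^2 + a + b = (0::int) \<longleftrightarrow> (a, b) \<in> {(0,0), (-1,0), (0,-1)}"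
proof
  assume *: "a^2 + a*b + b^2 + a + b = 0"
  have "(a+1)^2 + (b+1)^2 + (a+b)^2 = 2 * (a^2 + a*b + b^2 + a + b) + 2"
    by (simp add: power2_eq_square algebra_simps)
  with * have s: "(a+1)^2 + (b+1)^2 + (a+b)^2 = 2" by simp
  have sq: "\<bar>x\<bar> \<le> 1" if "x^2 \<le> 2" for x :: int
  proof (rule ccontr)
    assume "\<not> ?thesis"
    then have "2^2 \<le> \<bar>x\<bar>^2" by (intro power_mono) auto
    with that show False by simp
  qed
  have "\<bar>a+1\<bar> \<le> 1" "\<bar>b+1\<bar> \<le> 1" using s
    by (intro sq; smt (verit) zero_le_power2)+
  then have "a \<in> {-2,-1,0}" "b \<in> {-2,-1,0}" by auto
  with * show "(a, b) \<in> {(0,0), (-1,0), (0,-1)}" by auto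
qed auto

lemma hex_iff:
  "hex u v \<longleftrightarrow> hex_edge u v \<or> hex_edge v u"
  by (simp add: hex_def symclp_def)

lemma hex_sym: "hex u v \<Longrightarrow> hex v u" and hex_irrefl: "\<not> hex u u"
  by (auto simp: hex_iff hex_edge_def)

theorem hex_iff_dist_1: "hex u v \<longleftrightarrow> dist (hex_point u) (hex_point v) = 1"
proof -
  obtain i j c k l d where uv: "u = (i, j, c)" "v = (k, l, d)" by (metis surj_pair)
  define a b where "a = i - k" and "b = j - l"
  have D: "dist (hex_point u) (hex_point v) = 1 \<longleftrightarrow>
     3 * (a^2 + a*b + b^2) + 3 * (a + b) * (of_bool c - of_bool d) + (of_bool c - of_bool d)^2 = (1::int)"
    unfolding dist_1_iff uv hex_point_dist_sq a_def b_def of_int_eq_iff ..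
  show ?thesis
  proof (cases "c = d")
    case True
    have no: "3 * X \<noteq> 1" for X :: int by presburger
    have "\<not> hex u v" using True by (auto simp: hex_iff hex_edge_def uv)
    then show ?thesis using True no[of "a^2 + a*b + b^2"] by (simp add: D)
  next
    case False
    show ?thesis
    proof (cases c)
      case True
      with False have "dist (hex_point u) (hex_point v) = 1 \<longleftrightarrow> a^2 + a*b + b^2 + a + b = 0"
        by (auto simp: D)
      also have "\<dots> \<longleftrightarrow> hex u v" unfolding quadratic_1_iff
        using True False by (auto simp: hex_iff hex_edge_def uv a_def b_def)
      finally show ?thesis by simp
    next
      case c: False
      with False have "dist (hex_point u) (hex_point v) = 1 \<longleftrightarrow>
          (-a)^2 + (-a)*(-b) + (-b)^2 + (-a) + (-b) = 0"
        by (auto simp: D)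
      also have "\<dots> \<longleftrightarrow> hex u v" unfolding quadratic_1_iff
        using c False by (auto simp: hex_iff hex_edge_def uv a_def b_def)
      finally show ?thesis by simp
    qed
  qed
qed

lemma inj_hex_point: "inj hex_point"
proof (rule injI)
  fix u v assume eq: "hex_point u = hex_point v"
  obtain i j c k l d where uv: "u = (i, j, c)" "v = (k, l, d)" by (metis surj_pair)
  have "of_int (3 * ((i-k)^2 + (i-k)*(j-l) + (j-l)^2) +
       3 * (i-k + (j-l)) * (of_bool c - of_bool d) + (of_bool c - of_bool d)^2) = (of_int 0 :: real)"
    unfolding hex_point_dist_sq[symmetric] using eq by (simp add: uv)
  then have *: "3 * ((i-k)^2 + (i-k)*(j-l) + (j-l)^2) +
       3 * (i-k + (j-l)) * (of_bool c - of_bool d) + (of_bool c - of_bool d)^2 = (0::int)"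
    unfolding of_int_eq_iff .
  have no: "3 * X \<noteq> -1" for X :: int by presburger
  have "c = d"
  proof (rule ccontr)
    assume "c \<noteq> d"
    then have "(of_bool c - of_bool d :: int)^2 = 1" by (cases c) auto
    with * have "3 * (((i-k)^2 + (i-k)*(j-l) + (j-l)^2) +
       (i-k + (j-l)) * (of_bool c - of_bool d)) = (-1::int)" by (simp add: algebra_simps)
    then show False using no by blast
  qed
  with * have "(i-k)^2 + (i-k)*(j-l) + (j-l)^2 = 0" by simp
  then show "u = v" using \<open>c = d\<close> unfolding quadratic_form_0_iff by (simp add: uv)
qed

lemma hex_neighbours:
  "{v. hex (i, j, False) v} = {(i, j, True), (i - 1, j, True), (i, j - 1, True)}"
  "{v. hex (i, j, True) v} = {(i, j, False), (i + 1, j, False), (i, j + 1, False)}"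
  by (auto simp: hex_iff hex_edge_def)

lemma hex_3_regular: "card {v. hex u v} = 3"
proof -
  obtain i j c where "u = (i, j, c)" by (metis surj_pair)
  then show ?thesis by (cases c) (simp_all add: hex_neighbours)
qed

lemma graph_ball_iff_walk: "u \<in> graph_ball E v r \<longleftrightarrow> (\<exists>n\<le>r. (E ^^ n) v u)"
proof
  assume "u \<in> graph_ball E v r"
  then have le: "Inf (enat ` {n. (E ^^ n) v u}) \<le> enat r"
    by (simp add: graph_ball_def graph_dist_def)
  then have "enat ` {n. (E ^^ n) v u} \<noteq> {}" by (metis Inf_empty enat_ord_code(5) top_enat_def)
  then have "Inf (enat ` {n. (E ^^ n) v u}) \<in> enat ` {n. (E ^^ n) v u}"
    unfolding Inf_enat_def by (auto intro: LeastI)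
  with le show "\<exists>n\<le>r. (E ^^ n) v u" by auto
next
  assume "\<exists>n\<le>r. (E ^^ n) v u"
  then obtain n where "n \<le> r" "(E ^^ n) v u" by blast
  then have "Inf (enat ` {n. (E ^^ n) v u}) \<le> enat n" by (intro Inf_lower) auto
  also have "\<dots> \<le> enat r" using \<open>n \<le> r\<close> by simp
  finally show "u \<in> graph_ball E v r" by (simp add: graph_ball_def graph_dist_def)
qed

lemma finite_hex_ball: "finite (closed_nbhd hex v)" "finite (graph_ball hex v r)"
proof -
  have fin: "finite {u. hex w u}" for w by (rule card_ge_0_finite) (simp add: hex_3_regular)
  then show "finite (closed_nbhd hex v)" by (simp add: closed_nbhd_def)
  have walks: "finite {u. (hex ^^ n) v u}" for n
  proof (induction n)
    case (Suc n)
    have "{u. (hex ^^ Suc n) v u} = (\<Union>w\<in>{w. (hex ^^ n) v w}. {u. hex w u})" by auto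
    then show ?case using Suc fin by simp
  qed simp
  have "graph_ball hex v r = (\<Union>n\<le>r. {u. (hex ^^ n) v u})" by (auto simp: graph_ball_iff_walk)
  then show "finite (graph_ball hex v r)" using walks by simp
qed

end

(* Lower bound: write d(v) for the size of N[v] Int S. Two adjacent codewords v, w lie in both of the
   sets N[v] Int S and N[w] Int S, so these can differ in two elements only if d(v) + d(w) >= 6.
   Since all d(v) >= 2, this forces the share of v, the sum of 1/d(u) over u in N[v], to be at most
   1/2 + 1/4 + 1 = 7/4 (attained for d(v) = 2 and d(v) = 4). Double counting the shares gives
   |B_r| <= 7/4 |S Int B_{r+1}|, and a density below 4/7 would make the balls grow exponentially,
   whereas they grow quadratically.

   Upper bound: deleting every third diagonal leaves each vertex exactly two neighbours in the code,
   and two neighbours determine a vertex because the honeycomb has no 4-cycles. A row of the lattice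
   meets a ball in an interval, in which the code has density 2/3 up to a bounded error; there are
   only O(r) rows against a quadratic number of vertices. *)

theory Submission imports Defs "HOL-Real_Asymp.Real_Asymp" begin

section \<open>The share argument in cubic graphs\<close>

lemma red_ic_adjacent_codewords:
  assumes S: "red_ic E S" and E: "symp E" "irreflp E"
    and fin: "\<And>v. finite (closed_nbhd E v)"
    and vw: "v \<in> S" "w \<in> S" "E v w"
  shows "card (closed_nbhd E v \<inter> S) + card (closed_nbhd E w \<inter> S) \<ge> 6"
proof -
  let ?A = "closed_nbhd E v \<inter> S" and ?B = "closed_nbhd E w \<inter> S"
  have "v \<noteq> w" using vw E by (auto dest: irreflpD)
  have sub: "{v, w} \<subseteq> ?A" "{v, w} \<subseteq> ?B"
    using vw E by (auto simp: closed_nbhd_def dest: sympD)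
  have finA: "finite ?A" "finite ?B" using fin by auto
  have c2: "card {v, w} = 2" using \<open>v \<noteq> w\<close> by simp
  have "2 \<le> card (sym_diff ?A ?B)" using S \<open>v \<noteq> w\<close> unfolding red_ic_def by blast
  also have "\<dots> \<le> card ((?A - {v, w}) \<union> (?B - {v, w}))"
    using finA sub by (intro card_mono) auto
  also have "\<dots> \<le> card (?A - {v, w}) + card (?B - {v, w})" by (rule card_Un_le)
  also have "\<dots> = (card ?A - 2) + (card ?B - 2)"
    using card_Diff_subset[OF _ sub(1)] card_Diff_subset[OF _ sub(2)] c2 by simp
  \<comment> \<open>The subtractions are truncated; both sets contain \<open>{v, w}\<close>, so
    neither truncation occurs.\<close>
  finally show ?thesis using card_mono[OF finA(1) sub(1)] card_mono[OF finA(2) sub(2)] c2 by linarith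
qed

lemma red_ic_share_le:
  assumes S: "red_ic E S" and E: "symp E" "irreflp E" and cubic: "\<And>v. card {u. E v u} = 3"
    and v: "v \<in> S"
  shows "(\<Sum>u\<in>closed_nbhd E v. 1 / real (card (closed_nbhd E u \<inter> S))) \<le> 7 / 4"
proof -
  have finN: "finite {u. E w u}" for w by (rule card_ge_0_finite) (simp add: cubic)
  then have finC: "finite (closed_nbhd E w)" for w by (simp add: closed_nbhd_def)
  define d where "d u = card (closed_nbhd E u \<inter> S)" for u
  define I O' where "I = {u. E v u} \<inter> S" and "O' = {u. E v u} - S"
  have d2: "d u \<ge> 2" for u using S by (simp add: red_ic_def d_def)
  have nv: "v \<notin> {u. E v u}" using E by (auto dest: irreflpD)
  have "closed_nbhd E v \<inter> S = insert v I" using v by (auto simp: closed_nbhd_def I_def)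
  then have dv: "d v = Suc (card I)" using nv finN[of v] by (simp add: d_def I_def)
  have "{u. E v u} = I \<union> O'" by (auto simp: I_def O'_def)
  moreover have dis: "I \<inter> O' = {}" "finite I" "finite O'" using finN[of v] by (auto simp: I_def O'_def)
  ultimately have IO: "card I + card O' = 3" using cubic[of v] card_Un_disjoint by metis
  have split: "(\<Sum>u\<in>closed_nbhd E v. 1 / real (d u)) =
      1 / d v + ((\<Sum>u\<in>I. 1 / real (d u)) + (\<Sum>u\<in>O'. 1 / real (d u)))"
    unfolding closed_nbhd_def using nv finN[of v] \<open>{u. E v u} = I \<union> O'\<close> dis
    by (simp add: sum.union_disjoint)
  have O: "(\<Sum>u\<in>O'. 1 / real (d u)) \<le> card O' * (1 / 2)"
  proof (rule sum_bounded_above)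
    show "1 / real (d u) \<le> 1 / 2" for u using d2[of u] by (simp add: field_simps)
  qed
  \<comment> \<open>A neighbour in the code has \<open>d u\<close> at least \<open>6 - d v\<close>,
    and in any case at least 2.\<close>
  have I: "(\<Sum>u\<in>I. 1 / real (d u)) \<le> card I * (1 / real (max 2 (6 - d v)))"
  proof (rule sum_bounded_above)
    fix u assume "u \<in> I"
    then have "d v + d u \<ge> 6"
      unfolding d_def using red_ic_adjacent_codewords[OF S E finC v] by (auto simp: I_def)
    then have "max 2 (6 - d v) \<le> d u" using d2[of u] by simp
    then have "real (max 2 (6 - d v)) \<le> real (d u)" by (simp only: of_nat_le_iff)
    then show "1 / real (d u) \<le> 1 / real (max 2 (6 - d v))" by (intro divide_left_mono) auto
  qed
  have "card I \<ge> 1" using d2[of v] dv by simp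
  then consider "card I = 1" "card O' = 2" | "card I = 2" "card O' = 1" | "card I = 3" "card O' = 0"
    using IO by linarith
  \<comment> \<open>With \<open>d v = Suc (card I)\<close> the three cases give 1/2 + 1/4 + 2/2 =
    7/4, 1/3 + 2/3 + 1/2 = 3/2 and 1/4 + 3/2 = 7/4.\<close>
  then have "1 / d v + (card I * (1 / real (max 2 (6 - d v))) + card O' * (1 / 2)) \<le> 7 / 4"
    by cases (simp_all add: dv)
  with I O show ?thesis unfolding d_def[symmetric] split by linarith
qed

lemma graph_ball_mono: "r \<le> s \<Longrightarrow> graph_ball E v r \<subseteq> graph_ball E v s"
  unfolding graph_ball_iff_walk subset_iff by (meson order_trans)

lemma graph_ball_Suc:
  assumes "u \<in> graph_ball E v r" "w \<in> closed_nbhd E u"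
  shows "w \<in> graph_ball E v (Suc r)"
proof (cases "w = u")
  case True
  then show ?thesis using assms graph_ball_mono[of r "Suc r" E v] by auto
next
  case False
  then have "E u w" using assms by (simp add: closed_nbhd_def)
  moreover obtain n where "n \<le> r" "(E ^^ n) v u" using assms(1) by (auto simp: graph_ball_iff_walk)
  ultimately have "(E ^^ Suc n) v w" "Suc n \<le> Suc r" by auto
  then show ?thesis unfolding graph_ball_iff_walk by blast
qed

text \<open>Each vertex \<open>u\<close> of the ball spreads weight 1 evenly over the codewords in
  its closed neighbourhood. These lie within radius \<open>Suc r\<close>, and each codeword receives
  at most its share.\<close>

lemma card_graph_ball_le_code:
  assumes S: "red_ic E S" and E: "symp E" "irreflp E" and cubic: "\<And>v. card {u. E v u} = 3"
    and finB: "\<And>r. finite (graph_ball E v0 r)"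
  shows "4 * card (graph_ball E v0 r) \<le> 7 * card (S \<inter> graph_ball E v0 (Suc r))"
proof -
  have finC: "finite (closed_nbhd E w)" for w
    using cubic[of w] by (simp add: closed_nbhd_def card_ge_0_finite)
  define f where "f u = 1 / real (card (closed_nbhd E u \<inter> S))" for u
  let ?B = "graph_ball E v0 r" and ?T = "S \<inter> graph_ball E v0 (Suc r)"
  have finT: "finite ?T" using finB by auto
  have one: "(\<Sum>v | v \<in> ?T \<and> u \<in> closed_nbhd E v. f u) = 1" if "u \<in> ?B" for u
  proof -
    have "{v. v \<in> ?T \<and> u \<in> closed_nbhd E v} = closed_nbhd E u \<inter> S"
      using graph_ball_Suc[OF that] E(1) by (auto simp: closed_nbhd_def dest: sympD)
    moreover have "card (closed_nbhd E u \<inter> S) \<ge> 2" using S by (simp add: red_ic_def)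
    ultimately show ?thesis by (simp add: f_def)
  qed
  have "real (card ?B) = (\<Sum>u\<in>?B. \<Sum>v | v \<in> ?T \<and> u \<in> closed_nbhd E v. f u)"
    using one by simp
  also have "\<dots> = (\<Sum>v\<in>?T. \<Sum>u | u \<in> ?B \<and> u \<in> closed_nbhd E v. f u)"
    by (rule sum.swap_restrict[OF finB finT])
  also have "\<dots> \<le> (\<Sum>v\<in>?T. \<Sum>u\<in>closed_nbhd E v. f u)"
    by (intro sum_mono sum_mono2 finC) (auto simp: f_def)
  also have "\<dots> \<le> (\<Sum>v\<in>?T. 7 / 4)"
    using red_ic_share_le[OF S E cubic] by (intro sum_mono) (auto simp: f_def)
  finally have "4 * real (card ?B) \<le> 7 * real (card ?T)" by simp
  then show ?thesis by linarith
qed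

section \<open>Distances and balls in the honeycomb\<close>

text \<open>Sending \<open>(i, j, c)\<close> to \<open>(i, j, - i - j - of_bool c)\<close> identifies the honeycomb with the
  subgraph of the cubic lattice induced on the points with coordinate sum \<open>0\<close> or \<open>-1\<close>.
  This embedding is isometric.\<close>

definition hex_l1 :: "hex_vertex \<Rightarrow> hex_vertex \<Rightarrow> int" where
  "hex_l1 = (\<lambda>(i, j, c) (k, l, d). \<bar>k - i\<bar> + \<bar>l - j\<bar> + \<bar>(k + l + of_bool d) - (i + j + of_bool c)\<bar>)"

text \<open>An edge changes exactly one of the three cubic coordinates, and that one by 1.\<close>

lemma hex_l1_step: "hex v w \<Longrightarrow> hex_l1 u w \<le> hex_l1 u v + 1"
  by (cases u; cases v; cases w) (auto simp: hex_iff hex_edge_def hex_l1_def)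

lemma hex_l1_le_walk: "(hex ^^ n) u v \<Longrightarrow> hex_l1 u v \<le> int n"
proof (induction n arbitrary: v)
  case 0
  then show ?case by (cases u) (auto simp: hex_l1_def)
next
  case (Suc n)
  then obtain w where "(hex ^^ n) u w" "hex w v" by auto
  with Suc.IH[of w] hex_l1_step[of w v u] show ?case by simp
qed

text \<open>If \<open>v\<close> has coordinate sum 0, the maximal value, then some coordinate of
  \<open>v\<close> exceeds that of \<open>u\<close>, and lowering it by 1 gives a vertex of sum -1.
  If \<open>v\<close> has sum -1, some coordinate is too small and can be raised.\<close>

lemma hex_l1_decrease:
  assumes "u \<noteq> v"
  shows "\<exists>w. hex w v \<and> hex_l1 u w = hex_l1 u v - 1"
proof -
  obtain i j c k l d where uv: "u = (i, j, c)" "v = (k, l, d)" by (metis surj_pair)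
  show ?thesis
  proof (cases d)
    case False
    consider "k > i" | "l > j" | "k + l < i + j + of_bool c"
      using assms False unfolding uv by (cases c) (simp_all, linarith+)
    then show ?thesis
    proof cases
      case 1
      then have "hex (k - 1, l, True) v \<and> hex_l1 u (k - 1, l, True) = hex_l1 u v - 1"
        using False by (auto simp: uv hex_iff hex_edge_def hex_l1_def)
      then show ?thesis by blast
    next
      case 2
      then have "hex (k, l - 1, True) v \<and> hex_l1 u (k, l - 1, True) = hex_l1 u v - 1"
        using False by (auto simp: uv hex_iff hex_edge_def hex_l1_def)
      then show ?thesis by blast
    next
      case 3
      then have "hex (k, l, True) v \<and> hex_l1 u (k, l, True) = hex_l1 u v - 1"
        using False by (auto simp: uv hex_iff hex_edge_def hex_l1_def)
      then show ?thesis by blast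
    qed
  next
    case True
    consider "k < i" | "l < j" | "k + l + 1 > i + j + of_bool c"
      using assms True unfolding uv by (cases c) (simp_all, linarith+)
    then show ?thesis
    proof cases
      case 1
      then have "hex (k + 1, l, False) v \<and> hex_l1 u (k + 1, l, False) = hex_l1 u v - 1"
        using True by (auto simp: uv hex_iff hex_edge_def hex_l1_def)
      then show ?thesis by blast
    next
      case 2
      then have "hex (k, l + 1, False) v \<and> hex_l1 u (k, l + 1, False) = hex_l1 u v - 1"
        using True by (auto simp: uv hex_iff hex_edge_def hex_l1_def)
      then show ?thesis by blast
    next
      case 3
      then have "hex (k, l, False) v \<and> hex_l1 u (k, l, False) = hex_l1 u v - 1"
        using True by (auto simp: uv hex_iff hex_edge_def hex_l1_def)
      then show ?thesis by blast
    qed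
  qed
qed

lemma hex_l1_walk: "hex_l1 u v = int n \<Longrightarrow> (hex ^^ n) u v"
proof (induction n arbitrary: v)
  case 0
  then have "u = v" by (cases u; cases v; cases "snd (snd u)"; cases "snd (snd v)") (auto simp: hex_l1_def)
  then show ?case by simp
next
  case (Suc n)
  then have "u \<noteq> v" by (cases u) (auto simp: hex_l1_def)
  then obtain w where "hex w v" "hex_l1 u w = hex_l1 u v - 1" using hex_l1_decrease by blast
  with Suc have "(hex ^^ n) u w" by simp
  with \<open>hex w v\<close> show ?case by auto
qed

lemma hex_ball_iff: "u \<in> graph_ball hex v r \<longleftrightarrow> hex_l1 v u \<le> int r"
proof
  assume "u \<in> graph_ball hex v r"
  then obtain n where "n \<le> r" "(hex ^^ n) v u" by (auto simp: graph_ball_iff_walk)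
  then show "hex_l1 v u \<le> int r" using hex_l1_le_walk[of n v u] by linarith
next
  assume le: "hex_l1 v u \<le> int r"
  have "hex_l1 v u \<ge> 0" by (auto simp: hex_l1_def split: prod.split)
  then obtain n where "hex_l1 v u = int n" using nonneg_int_cases by blast
  with le hex_l1_walk[of v u n] show "u \<in> graph_ball hex v r"
    unfolding graph_ball_iff_walk by (intro exI[of _ n]) simp
qed

section \<open>Quadratic growth of balls and the lower bound on density\<close>

lemma card_hex_ball_le: "card (graph_ball hex v r) \<le> 2 * (2 * r + 1)\<^sup>2"
proof -
  obtain i j c where v: "v = (i, j, c)" by (metis surj_pair)
  let ?X = "{i - int r..i + int r} \<times> {j - int r..j + int r} \<times> (UNIV :: bool set)"
  have "graph_ball hex v r \<subseteq> ?X" by (auto simp: hex_ball_iff v hex_l1_def)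
  then have "card (graph_ball hex v r) \<le> card ?X" by (intro card_mono) auto
  also have "\<dots> = nat (2 * int r + 1) * (nat (2 * int r + 1) * 2)"
    by (simp add: card_cartesian_product)
  also have "nat (2 * int r + 1) = 2 * r + 1" by simp
  finally show ?thesis by (simp add: power2_eq_square)
qed

lemma card_hex_ball_ge: "(r + 1)\<^sup>2 \<le> 16 * card (graph_ball hex v r)"
proof -
  obtain i j c where v: "v = (i, j, c)" by (metis surj_pair)
  \<comment> \<open>Offsets \<open>x\<close> and \<open>y\<close> cost x + y + (x + y) in
    \<open>hex_l1\<close>, hence at most 4 * \<open>?q\<close>.\<close>
  let ?q = "r div 4"
  let ?f = "\<lambda>(x::nat, y::nat). (i + int x, j + int y, c)"
  have "?f ` ({..?q} \<times> {..?q}) \<subseteq> graph_ball hex v r"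
    by (auto simp: hex_ball_iff v hex_l1_def)
  moreover have "inj_on ?f ({..?q} \<times> {..?q})" by (auto simp: inj_on_def)
  ultimately have "card ({..?q} \<times> {..?q}) \<le> card (graph_ball hex v r)"
    using card_inj_on_le finite_hex_ball(2) by blast
  then have "(?q + 1)\<^sup>2 \<le> card (graph_ball hex v r)"
    by (simp add: card_cartesian_product power2_eq_square)
  moreover have "r + 1 \<le> 4 * (?q + 1)" by presburger
  then have "(r + 1)\<^sup>2 \<le> (4 * (?q + 1))\<^sup>2" by (rule power_mono) simp
  ultimately show ?thesis unfolding power_mult_distrib by simp
qed

lemma hex_code_density_ge:
  assumes "red_ic hex S"
  shows "ereal (4 / 7) \<le> code_density hex v0 S"
proof (rule ccontr)
  define b where "b r = real (card (graph_ball hex v0 r))" for r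
  define s where "s r = real (card (S \<inter> graph_ball hex v0 r))" for r
  assume "\<not> ereal (4 / 7) \<le> code_density hex v0 S"
  then have "limsup (\<lambda>r. ereal (s r / b r)) < ereal (4 / 7)"
    by (simp add: code_density_def b_def s_def)
  then obtain c where c: "limsup (\<lambda>r. ereal (s r / b r)) < ereal c" "ereal c < ereal (4 / 7)"
    using ereal_dense2 by blast
  have "eventually (\<lambda>r. ereal (s r / b r) < ereal c) sequentially"
    using c(1) by (rule Limsup_lessD)
  then obtain R where R: "\<And>r. r \<ge> R \<Longrightarrow> s r / b r < c"
    unfolding eventually_sequentially by auto
  \<comment> \<open>Since \<open>c\<close> is below 4/7, \<open>q\<close> is below 1; the maximum
    with 1/2 keeps it positive whatever the sign of \<open>c\<close>.\<close>
  define q where "q = max (1 / 2) (7 / 4 * c)"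
  have q: "0 < q" "q < 1" using c(2) by (auto simp: q_def)
  have bpos: "b r \<ge> 1 / 16" for r
  proof -
    have "1 \<le> (r + 1)\<^sup>2" by simp
    also have "\<dots> \<le> 16 * card (graph_ball hex v0 r)" by (rule card_hex_ball_ge)
    finally have "1 \<le> real (16 * card (graph_ball hex v0 r))" by linarith
    then show ?thesis by (simp add: b_def)
  qed
  have step: "b r \<le> q * b (Suc r)" if "r \<ge> R" for r
  proof -
    have "4 * b r \<le> 7 * s (Suc r)"
      using card_graph_ball_le_code[OF assms, of v0 r] hex_3_regular finite_hex_ball(2)
        hex_sym hex_irrefl unfolding b_def s_def by (auto simp: symp_def irreflp_def)
    moreover have "s (Suc r) \<le> c * b (Suc r)"
      using R[of "Suc r"] bpos[of "Suc r"] that by (simp add: field_simps)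
    moreover have "7 / 4 * c * b (Suc r) \<le> q * b (Suc r)"
      using bpos[of "Suc r"] by (intro mult_right_mono) (auto simp: q_def)
    ultimately show ?thesis by linarith
  qed
  have exp: "b R \<le> q ^ n * b (R + n)" for n
  proof (induction n)
    case (Suc n)
    have "q ^ n * b (R + n) \<le> q ^ n * (q * b (R + Suc n))"
      using step[of "R + n"] q by (intro mult_left_mono) auto
    with Suc show ?case by (simp add: mult_ac)
  qed simp
  have "1 / 16 \<le> q ^ n * (2 * (2 * (real R + real n) + 1)\<^sup>2)" for n
  proof -
    have "b (R + n) \<le> real (2 * (2 * (R + n) + 1)\<^sup>2)"
      unfolding b_def using card_hex_ball_le by (simp only: of_nat_le_iff)
    then have "q ^ n * b (R + n) \<le> q ^ n * (2 * (2 * (real R + real n) + 1)\<^sup>2)"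
      using q by (intro mult_left_mono) (auto simp: algebra_simps)
    with exp[of n] bpos[of R] show ?thesis by linarith
  qed
  moreover have "(\<lambda>n. q ^ n * (2 * (2 * (real R + real n) + 1)\<^sup>2)) \<longlonglongrightarrow> 0"
    using q by real_asymp
  ultimately show False
    using LIMSEQ_le_const[of _ 0 "1 / 16"] by fastforce
qed

section \<open>A code of density 2/3\<close>

text \<open>The residue ignores \<open>c\<close>, so the edge joining \<open>(i, j, False)\<close>
  and \<open>(i, j, True)\<close> is kept or deleted as a whole.\<close>

definition hex_code :: "hex_vertex set" where
  "hex_code = {(i, j, c). (i - j) mod 3 \<noteq> 0}"

text \<open>Otherwise \<open>u\<close>, \<open>w\<close>, \<open>v\<close>, \<open>x\<close> form a
  4-cycle, or a triangle if \<open>v\<close> is \<open>w\<close> or \<open>x\<close>; the honeycomb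
  has neither.\<close>

lemma hex_two_neighbours_unique:
  assumes "w \<noteq> x" "hex u w" "hex u x" "w \<in> closed_nbhd hex v" "x \<in> closed_nbhd hex v"
  shows "u = v"
  using assms by (cases u; cases v; cases w; cases x) (auto simp: closed_nbhd_def hex_iff hex_edge_def)

text \<open>The three neighbours of a vertex have pairwise different residues \<open>(i - j) mod 3\<close>.\<close>

lemma hex_code_two_neighbours: "\<exists>w x. w \<noteq> x \<and> {w, x} \<subseteq> {w. hex u w} \<inter> hex_code"
proof -
  obtain i j c where u: "u = (i, j, c)" by (metis surj_pair)
  \<comment> \<open>The sign \<open>s\<close> treats both sublattices at once: neighbours of a
    \<open>True\<close> vertex shift up, those of a \<open>False\<close> vertex down.\<close>
  define s :: int where "s = (if c then 1 else -1)"
  have N: "{w. hex u w} = {(i, j, \<not> c), (i + s, j, \<not> c), (i, j + s, \<not> c)}"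
    by (cases c) (simp_all add: u s_def hex_neighbours)
  have "(k + 1) mod 3 \<noteq> 0 \<and> (k - 1) mod 3 \<noteq> 0 \<or> k mod 3 \<noteq> 0 \<and> ((k + 1) mod 3 \<noteq> 0 \<or> (k - 1) mod 3 \<noteq> 0)"
    for k :: int by presburger
  from this[of "i - j"]
  consider "(i + s - j) mod 3 \<noteq> 0" "(i - (j + s)) mod 3 \<noteq> 0"
    | "(i - j) mod 3 \<noteq> 0" "(i - (j + s)) mod 3 \<noteq> 0"
    | "(i - j) mod 3 \<noteq> 0" "(i + s - j) mod 3 \<noteq> 0"
    by (cases c) (auto simp: s_def algebra_simps)
  then show ?thesis
  proof cases
    case 1
    then show ?thesis unfolding N
      by (intro exI[of _ "(i + s, j, \<not> c)"] exI[of _ "(i, j + s, \<not> c)"]) (simp add: hex_code_def s_def)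
  next
    case 2
    then show ?thesis unfolding N
      by (intro exI[of _ "(i, j, \<not> c)"] exI[of _ "(i, j + s, \<not> c)"]) (simp add: hex_code_def s_def)
  next
    case 3
    then show ?thesis unfolding N
      by (intro exI[of _ "(i, j, \<not> c)"] exI[of _ "(i + s, j, \<not> c)"]) (simp add: hex_code_def s_def)
  qed
qed

text \<open>The two code neighbours of \<open>u\<close> cannot both lie in the closed neighbourhood
  of another vertex \<open>v\<close>, and conversely. So each of the two traces contributes an
  element to the symmetric difference.\<close>

lemma red_ic_hex_code: "red_ic hex hex_code"
proof -
  have two: "\<exists>w x. w \<noteq> x \<and> w \<in> closed_nbhd hex u \<inter> hex_code \<and> x \<in> closed_nbhd hex u \<inter> hex_code
      \<and> hex u w \<and> hex u x" for u
    using hex_code_two_neighbours[of u] unfolding closed_nbhd_def by blast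
  have fin: "finite (closed_nbhd hex u \<inter> hex_code)" for u using finite_hex_ball(1) by blast
  have "card (closed_nbhd hex u \<inter> hex_code) \<ge> 2" for u
  proof -
    obtain w x where "w \<noteq> x" "{w, x} \<subseteq> closed_nbhd hex u \<inter> hex_code" using two[of u] by blast
    then show ?thesis using card_mono[OF fin[of u], of "{w, x}"] by simp
  qed
  moreover have "card (sym_diff (closed_nbhd hex u \<inter> hex_code) (closed_nbhd hex v \<inter> hex_code)) \<ge> 2"
    (is "card (sym_diff ?A ?B) \<ge> 2") if "u \<noteq> v" for u v
  proof -
    have "\<not> ?A \<subseteq> ?B" using two[of u] hex_two_neighbours_unique that by blast
    then obtain a where a: "a \<in> ?A" "a \<notin> ?B" by blast
    have "\<not> ?B \<subseteq> ?A" using two[of v] hex_two_neighbours_unique that by blast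
    then obtain b where b: "b \<in> ?B" "b \<notin> ?A" by blast
    have "{a, b} \<subseteq> sym_diff ?A ?B" using a b by blast
    then have "card {a, b} \<le> card (sym_diff ?A ?B)" using fin by (intro card_mono) auto
    moreover have "a \<noteq> b" using a b by blast
    ultimately show ?thesis by simp
  qed
  ultimately show ?thesis by (simp add: red_ic_def)
qed

section \<open>Counting the code in balls row by row\<close>

lemma card_interval_mod3_ne:
  fixes a m :: int
  shows "3 * card {k \<in> {a..<a + int n}. (k - m) mod 3 \<noteq> 0} \<le> 2 * n + 2"
proof (induction n rule: less_induct)
  case (less n)
  show ?case
  proof (cases "n < 3")
    \<comment> \<open>The additive 2 is for these short intervals: 3 * \<open>n\<close> is at most 2
      * \<open>n\<close> + 2 when \<open>n\<close> is at most 2.\<close>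
    case True
    have "card {k \<in> {a..<a + int n}. (k - m) mod 3 \<noteq> 0} \<le> card {a..<a + int n}"
      by (intro card_mono) auto
    with True show ?thesis by simp
  next
    case False
    define p where "p = n - 3"
    have n: "n = p + 3" using False by (simp add: p_def)
    let ?P = "\<lambda>k. (k - m) mod 3 \<noteq> 0"
    \<comment> \<open>Of three consecutive integers one is congruent to \<open>m\<close>, so cutting
      them off removes at most two counted elements.\<close>
    let ?T = "{k \<in> {a + int p, a + int p + 1, a + int p + 2}. ?P k}"
    have "{k \<in> {a..<a + int n}. ?P k} = {k \<in> {a..<a + int p}. ?P k} \<union> ?T"
      by (auto simp: n)
    then have "card {k \<in> {a..<a + int n}. ?P k} \<le> card {k \<in> {a..<a + int p}. ?P k} + card ?T"
      by (simp add: card_Un_le)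
    moreover have "card ?T \<le> 2"
    proof -
      have "\<not> ?P (a + int p) \<or> \<not> ?P (a + int p + 1) \<or> \<not> ?P (a + int p + 2)" by presburger
      then consider "\<not> ?P (a + int p)" | "\<not> ?P (a + int p + 1)" | "\<not> ?P (a + int p + 2)" by blast
      then have "?T \<subseteq> {a + int p + 1, a + int p + 2} \<or> ?T \<subseteq> {a + int p, a + int p + 2}
          \<or> ?T \<subseteq> {a + int p, a + int p + 1}"
        by cases auto
      then obtain x y where "?T \<subseteq> {x, y}" by (elim disjE) (rule that)
      then have "card ?T \<le> card {x, y}" by (intro card_mono) auto
      also have "\<dots> \<le> 2" by (simp add: card_insert_if)
      finally show ?thesis .
    qed
    ultimately show ?thesis using less.IH[of p] n by simp
  qed
qed

text \<open>The half-open form includes the empty set and matches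
  \<open>card_interval_mod3_ne\<close>.\<close>

lemma finite_convex_int_interval:
  fixes K :: "int set"
  assumes "finite K" "\<And>x y z. x \<in> K \<Longrightarrow> z \<in> K \<Longrightarrow> x \<le> y \<Longrightarrow> y \<le> z \<Longrightarrow> y \<in> K"
  shows "\<exists>a. K = {a..<a + int (card K)}"
proof (cases "K = {}")
  case False
  have "y \<in> K" if "Min K \<le> y" "y \<le> Max K" for y
    by (rule assms(2)[OF Min_in[OF assms(1) False] Max_in[OF assms(1) False] that])
  then have "{Min K..Max K} \<subseteq> K" by (meson atLeastAtMost_iff subsetI)
  moreover have "K \<subseteq> {Min K..Max K}" using Min_le Max_ge assms(1) by (meson atLeastAtMost_iff subsetI)
  ultimately have K: "K = {Min K..Max K}" by (rule equalityI[rotated])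
  have "Min K \<le> Max K" using assms(1) False by simp
  moreover have "card K = card {Min K..Max K}" using K by (rule arg_cong)
  ultimately have "int (card K) = Max K - Min K + 1" by simp
  then have "{Min K..Max K} = {Min K..<Min K + int (card K)}"
    by (simp add: atLeastLessThanPlusOne_atLeastAtMost_int)
  with K have "K = {Min K..<Min K + int (card K)}" by (rule trans)
  then show ?thesis by blast
qed simp

lemma card_eq_sum_rows:
  fixes A :: "('a \<times> 'b) set"
  assumes "finite A" "finite T" "snd ` A \<subseteq> T"
  shows "card A = (\<Sum>t\<in>T. card {k. (k, t) \<in> A})"
proof -
  have "card {k. (k, t) \<in> A} = card {x \<in> A. snd x = t}" for t
    by (rule bij_betw_same_card[of "\<lambda>k. (k, t)"]) (auto simp: bij_betw_def inj_on_def)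
  then show ?thesis using sum.group[OF assms, of "\<lambda>_. 1::nat"] by simp
qed

text \<open>A row fixes the second coordinate and the sublattice. At most 2 * (2 * \<open>r\<close>
  + 1) rows meet the ball, each with error 2.\<close>

lemma card_hex_code_ball:
  "3 * card (hex_code \<inter> graph_ball hex v r) \<le> 2 * card (graph_ball hex v r) + 4 * (2 * r + 1)"
proof -
  obtain i j c where v: "v = (i, j, c)" by (metis surj_pair)
  let ?B = "graph_ball hex v r"
  let ?T = "{j - int r..j + int r} \<times> (UNIV :: bool set)"
  have T: "snd ` ?B \<subseteq> ?T" by (auto simp: hex_ball_iff v hex_l1_def)
  have fin: "finite ?B" by (rule finite_hex_ball)
  have row: "3 * card {k. (k, t) \<in> hex_code \<inter> ?B} \<le> 2 * card {k. (k, t) \<in> ?B} + 2" for t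
  proof -
    obtain l d where t: "t = (l, d)" by (metis surj_pair)
    let ?K = "{k. (k, t) \<in> ?B}"
    have "finite ?K" by (rule finite_surj[OF fin, of _ fst]) force
    moreover have "y \<in> ?K" if "x \<in> ?K" "z \<in> ?K" "x \<le> y" "y \<le> z" for x y z
    proof -
      \<comment> \<open>Along a row \<open>hex_l1\<close> is a convex function of the first
        coordinate.\<close>
      have "hex_l1 v (y, t) \<le> max (hex_l1 v (x, t)) (hex_l1 v (z, t))"
        using that(3,4) unfolding t v hex_l1_def prod.case by linarith
      with that(1,2) show ?thesis by (simp add: hex_ball_iff)
    qed
    ultimately obtain a where a: "?K = {a..<a + int (card ?K)}"
      using finite_convex_int_interval[of ?K] by blast
    have "{k. (k, t) \<in> hex_code \<inter> ?B} = {k \<in> ?K. (k - l) mod 3 \<noteq> 0}"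
      by (auto simp: hex_code_def t)
    then show ?thesis using card_interval_mod3_ne[of a "card ?K" l] a by simp
  qed
  have "card (hex_code \<inter> ?B) = (\<Sum>t\<in>?T. card {k. (k, t) \<in> hex_code \<inter> ?B})"
    using T fin by (intro card_eq_sum_rows) auto
  then have "3 * card (hex_code \<inter> ?B) = (\<Sum>t\<in>?T. 3 * card {k. (k, t) \<in> hex_code \<inter> ?B})"
    by (simp only: sum_distrib_left)
  also have "\<dots> \<le> (\<Sum>t\<in>?T. 2 * card {k. (k, t) \<in> ?B} + 2)" by (intro sum_mono row)
  also have "\<dots> = 2 * card ?B + 2 * card ?T"
    using card_eq_sum_rows[OF fin _ T] by (simp only: sum.distrib sum_distrib_left[symmetric]) simp
  also have "card ?T = 2 * (2 * r + 1)" by (simp add: card_cartesian_product)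
  finally show ?thesis by simp
qed

lemma code_density_hex_code: "code_density hex v0 hex_code \<le> ereal (2 / 3)"
proof -
  \<comment> \<open>The factor 64/3 is 4/3 from the row errors times 16 from
    \<open>card_hex_ball_ge\<close>.\<close>
  define g where "g r = 2 / 3 + 64 * (2 * real r + 1) / (3 * (real r + 1)\<^sup>2)" for r
  have "real (card (hex_code \<inter> graph_ball hex v0 r)) / real (card (graph_ball hex v0 r)) \<le> g r" for r
  proof -
    define s b where "s = real (card (hex_code \<inter> graph_ball hex v0 r))"
      and "b = real (card (graph_ball hex v0 r))"
    have "real (3 * card (hex_code \<inter> graph_ball hex v0 r))
        \<le> real (2 * card (graph_ball hex v0 r) + 4 * (2 * r + 1))"
      using card_hex_code_ball by (simp only: of_nat_le_iff)
    then have "3 * s \<le> 2 * b + 4 * (2 * real r + 1)" by (simp add: s_def b_def)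
    then have s: "s \<le> 2 / 3 * b + 4 / 3 * (2 * real r + 1)" by argo
    have "real ((r + 1)\<^sup>2) \<le> real (16 * card (graph_ball hex v0 r))"
      using card_hex_ball_ge by (simp only: of_nat_le_iff)
    then have b: "(real r + 1)\<^sup>2 / 16 \<le> b" by (simp add: b_def add.commute)
    have p: "(real r + 1)\<^sup>2 / 16 > 0" by (simp add: add_nonneg_eq_0_iff)
    have "s / b \<le> 2 / 3 + 4 / 3 * (2 * real r + 1) / b"
      using divide_right_mono[OF s, of b] b p by (simp add: add_divide_distrib)
    also have "\<dots> \<le> 2 / 3 + 4 / 3 * (2 * real r + 1) / ((real r + 1)\<^sup>2 / 16)"
      using b p order_less_le_trans[OF p b] by (intro add_left_mono divide_left_mono mult_pos_pos) auto
    finally show ?thesis by (simp add: s_def b_def g_def)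
  qed
  then have "code_density hex v0 hex_code \<le> limsup (\<lambda>r. ereal (g r))"
    unfolding code_density_def by (intro Limsup_mono) simp
  also have "g \<longlonglongrightarrow> 2 / 3" unfolding g_def by real_asymp
  then have "limsup (\<lambda>r. ereal (g r)) = ereal (2 / 3)" by (intro lim_imp_Limsup) auto
  finally show ?thesis .
qed

theorem theorem13:
  fixes v0 :: hex_vertex
  shows "ereal (4 / 7) \<le> red_ic_percent hex v0 \<and> red_ic_percent hex v0 \<le> ereal (2 / 3)"
proof
  show "ereal (4 / 7) \<le> red_ic_percent hex v0"
    unfolding red_ic_percent_def by (rule INF_greatest) (simp add: hex_code_density_ge)
  have "red_ic_percent hex v0 \<le> code_density hex v0 hex_code"
    unfolding red_ic_percent_def by (rule INF_lower) (simp add: red_ic_hex_code)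
  then show "red_ic_percent hex v0 \<le> ereal (2 / 3)" using code_density_hex_code order_trans by blast
qed

end
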